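(* Let $q$ be a power of a prime, let $n\ge 3$ and $s\ge 1$ be integers with $\gcd(s,n)=1$, and put $\sigma=q^s$. Let $b\in\mathbb F_{q^n}^*$. The polynomial $x^\sigma+bx^{\sigma^2}\in\mathbb F_{q^n}[x]$ is not scattered if and only if the algebraic curve $b^{-1}X^{q-1}+Y^{\sigma-1}+1=0$ in the affine plane $\mathrm{AG}(2,q^n)$ over $\mathbb F_{q^n}$ has a point $(x_0,y_0)$ with coordinates $x_0,y_0\in\mathbb F_{q^n}^*$ such that $\mathrm{Tr}_{q^n/q}(y_0)=0$.
   Context: $\mathbb F_{q^n}$ is the finite field with $q^n$ elements, $\mathbb F_{q^n}^*=\mathbb F_{q^n}\setminus\{0\}$, and $\mathrm{Tr}_{q^n/q}(z)=\sum_{i=0}^{n-1}z^{q^i}$ is the trace over $\mathbb F_q$ of $z\in\mathbb F_{q^n}$. A linearized polynomial $f$ over $\mathbb F_{q^n}$ (an $\mathbb F_q$-linear map $\mathbb F_{q^n}\to\mathbb F_{q^n}$) is called scattered if for any $t,x\in\mathbb F_{q^n}$ the condition $xf(t)-tf(x)=0$ holds if and only if $x$ and $t$ are $\mathbb F_q$-linearly dependent. *)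

theory Defs
  imports
    "HOL-Computational_Algebra.Computational_Algebra"
    "HOL-Number_Theory.Prime_Powers"
    "HOL-Library.Cardinality"
begin

text \<open>
  The field with \<open>q ^ n\<close> elements is a type of class \<open>finite_field\<close> with cardinality \<open>q ^ n\<close>.
  Its subfield with \<open>q\<close> elements is realised as a subset, namely the fixed points of
  \<open>x \<mapsto> x ^ q\<close>; the lemmas below show that this is a subfield, that it has \<open>q\<close> elements, and
  that it is the only such subfield.
\<close>

definition subfield_of_order :: "nat \<Rightarrow> 'a::finite_field set" where
  "subfield_of_order q = {x. x ^ q = x}"

definition trace_over :: "nat \<Rightarrow> nat \<Rightarrow> 'a::finite_field \<Rightarrow> 'a" where
  "trace_over q n z = (\<Sum>i<n. z ^ (q ^ i))"

text \<open>
  Linear dependence of the pair \<open>(x, t)\<close>, so that \<open>(x, x)\<close> counts as dependent.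
\<close>

definition lin_dependent_pair :: "nat \<Rightarrow> 'a::finite_field \<Rightarrow> 'a \<Rightarrow> bool" where
  "lin_dependent_pair q x t \<longleftrightarrow>
     (\<exists>\<alpha>\<in>subfield_of_order q. \<exists>\<beta>\<in>subfield_of_order q.
        (\<alpha>, \<beta>) \<noteq> (0, 0) \<and> \<alpha> * x + \<beta> * t = 0)"

definition linearized_poly :: "nat \<Rightarrow> 'a::finite_field poly \<Rightarrow> bool" where
  "linearized_poly q f \<longleftrightarrow> (\<forall>k. coeff f k \<noteq> 0 \<longrightarrow> (\<exists>i. k = q ^ i))"

definition scattered :: "nat \<Rightarrow> 'a::finite_field poly \<Rightarrow> bool" where
  "scattered q f \<longleftrightarrow> linearized_poly q f \<and>
     (\<forall>t x. x * poly f t - t * poly f x = 0 \<longleftrightarrow> lin_dependent_pair q x t)"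

text \<open>
  The points over the ground field \<open>'a\<close> of the affine curve \<open>b\<inverse> X ^ (q - 1) + Y ^ (\<sigma> - 1) + 1 = 0\<close>.
\<close>

definition curve_points :: "nat \<Rightarrow> nat \<Rightarrow> 'a::finite_field \<Rightarrow> ('a \<times> 'a) set" where
  "curve_points q \<sigma> b = {(x, y). inverse b * x ^ (q - 1) + y ^ (\<sigma> - 1) + 1 = 0}"


lemma prime_power_CHAR:
  assumes q: "primepow q" and card: "CARD('a::finite_field) = q ^ n"
  shows "\<exists>k>0. q = CHAR('a) ^ k"
proof -
  obtain p k where pk: "prime p" "k > 0" "q = p ^ k"
    using q by (auto simp: primepow_def)
  have "(\<Sum>x\<in>UNIV. x + 1) = (\<Sum>x\<in>UNIV. x :: 'a)"
    by (rule sum.reindex_bij_witness[of _ "\<lambda>x. x - 1" "\<lambda>x. x + 1"]) auto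
  hence "of_nat CARD('a) = (0 :: 'a)" by (simp add: sum.distrib)
  hence "CHAR('a) dvd p ^ (k * n)"
    using card pk by (simp add: of_nat_eq_0_iff_char_dvd power_mult del: of_nat_power)
  moreover have "prime CHAR('a)"
    by simp
  ultimately have "CHAR('a) = p"
    using pk(1) by (metis prime_dvd_power primes_dvd_imp_eq)
  thus ?thesis using pk by auto
qed

lemma subfield_of_order_closed:
  assumes q: "primepow q" and card: "CARD('a::finite_field) = q ^ n"
  defines "K \<equiv> (subfield_of_order q :: 'a set)"
  shows "0 \<in> K" "1 \<in> K"
    and "x \<in> K \<Longrightarrow> y \<in> K \<Longrightarrow> x + y \<in> K"
    and "x \<in> K \<Longrightarrow> - x \<in> K"
    and "x \<in> K \<Longrightarrow> y \<in> K \<Longrightarrow> x * y \<in> K"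
    and "x \<in> K \<Longrightarrow> inverse x \<in> K"
proof -
  obtain k where k: "k > 0" "q = CHAR('a) ^ k"
    using prime_power_CHAR[OF q card] by blast
  have q0: "q > 0" using k by simp
  have add: "(u + v) ^ q = u ^ q + v ^ q" for u v :: 'a
    by (rule freshmans_dream'[where n = k]) (use k in auto)
  show "0 \<in> K" "1 \<in> K"
    using q0 by (auto simp: K_def subfield_of_order_def)
  show "x \<in> K \<Longrightarrow> y \<in> K \<Longrightarrow> x + y \<in> K"
    by (simp add: K_def subfield_of_order_def add)
  show "x \<in> K \<Longrightarrow> - x \<in> K"
    using add[of x "- x"] q0
    by (simp add: K_def subfield_of_order_def) (metis add_eq_0_iff power_eq_0_iff)
  show "x \<in> K \<Longrightarrow> y \<in> K \<Longrightarrow> x * y \<in> K"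
    by (simp add: K_def subfield_of_order_def power_mult_distrib)
  show "x \<in> K \<Longrightarrow> inverse x \<in> K"
    by (simp add: K_def subfield_of_order_def power_inverse)
qed

lemma card_subfield_of_order:
  assumes q: "primepow q" and card: "CARD('a::finite_field) = q ^ n" and n: "n > 0"
  shows "card (subfield_of_order q :: 'a set) = q"
proof (rule antisym)
  have q1: "q > 1" using primepow_gt_Suc_0[OF q] by simp
  let ?K = "subfield_of_order q :: 'a set"
  let ?f = "monom 1 q - monom 1 1 :: 'a poly"
  have "coeff ?f q = 1" using q1 by simp
  hence "?f \<noteq> 0" by (metis coeff_0 zero_neq_one)
  hence "card {x. poly ?f x = 0} \<le> degree ?f" by (rule card_poly_roots_bound)
  also have "degree ?f \<le> q"
    by (rule degree_diff_le) (use q1 in \<open>auto simp: degree_monom_eq\<close>)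
  also have "{x. poly ?f x = 0} = ?K"
    by (auto simp: subfield_of_order_def poly_monom)
  finally show "card ?K \<le> q" .

  have "int q - 1 dvd int q ^ n - 1"
    by (simp add: power_diff_1_eq)
  hence "int (q - 1) dvd int (q ^ n - 1)"
    using q1 by (simp add: of_nat_diff)
  hence "q - 1 dvd q ^ n - 1"
    by (simp only: int_dvd_int_iff)
  then obtain m where m: "q ^ n - 1 = (q - 1) * m" by blast
  have "q ^ n > 1" using q1 n by (rule one_less_power)
  hence m0: "m > 0" using m by (cases m) auto
  define g where "g = (\<Sum>i<m. monom 1 ((q - 1) * i) :: 'a poly)"
  have "coeff g 0 = (\<Sum>i<m. if i = 0 then 1 else 0)"
    unfolding g_def coeff_sum coeff_monom by (rule sum.cong) (use q1 in simp_all)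
  also have "\<dots> = 1" using m0 by simp
  finally have g0: "g \<noteq> 0" by auto
  have "degree g \<le> (q - 1) * (m - 1)"
    unfolding g_def by (rule degree_sum_le) (auto simp: degree_monom_eq)
  hence deg: "card {x. poly g x = 0} \<le> (q - 1) * (m - 1)"
    using card_poly_roots_bound[OF g0] by simp
  have "x \<in> ?K \<or> poly g x = 0" for x
  proof (cases "x = 0")
    case True
    thus ?thesis using q1 by (auto simp: subfield_of_order_def)
  next
    case False
    define y where "y = x ^ (q - 1)"
    have "x * x ^ (q ^ n - 1) = x"
      using finite_field_power_card_eq_same[of x] card q1
      by (simp flip: power_Suc)
    hence "y ^ m = 1" using False m by (simp add: y_def power_mult)
    moreover have "y ^ m - 1 = (y - 1) * (\<Sum>i<m. y ^ i)" by (rule power_diff_1_eq)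
    moreover have "poly g x = (\<Sum>i<m. y ^ i)"
      by (simp add: g_def poly_sum poly_monom y_def power_mult)
    moreover have "x ^ q = x * y" using q1 by (simp add: y_def flip: power_Suc)
    ultimately show ?thesis by (auto simp: subfield_of_order_def)
  qed
  hence "UNIV = ?K \<union> {x. poly g x = 0}" by auto
  hence "q ^ n \<le> card ?K + card {x. poly g x = 0}"
    using card card_Un_le[of ?K "{x. poly g x = 0}"] by simp
  also have "\<dots> \<le> card ?K + (q - 1) * (m - 1)" using deg by simp
  finally have "q ^ n \<le> card ?K + (q - 1) * (m - 1)" .
  moreover have "q ^ n = (q - 1) * (m - 1) + q"
  proof -
    have "(q - 1) * m = (q - 1) * (m - 1) + (q - 1)"
      using m0 by (cases m) simp_all
    thus ?thesis using m q1 \<open>q ^ n > 1\<close> by linarith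
  qed
  ultimately show "q \<le> card ?K" by linarith
qed

lemma subfield_of_order_unique:
  fixes K :: "'a::finite_field set"
  assumes q: "primepow q" and card: "CARD('a) = q ^ n" and n: "n > 0"
    and "0 \<in> K" "card K = q" and mult: "\<And>x y. x \<in> K \<Longrightarrow> y \<in> K \<Longrightarrow> x * y \<in> K"
  shows "K = subfield_of_order q"
proof -
  have "x ^ q = x" if x: "x \<in> K" for x
  proof (cases "x = 0")
    case False
    have "(\<lambda>y. x * y) ` (K - {0}) = K - {0}"
      by (rule endo_inj_surj) (use False x mult in \<open>auto simp: inj_on_def\<close>)
    moreover have "inj_on (\<lambda>y. x * y) (K - {0})" using False by (auto simp: inj_on_def)
    ultimately have "(\<Prod>y\<in>K - {0}. x * y) = \<Prod>(K - {0})"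
      using prod.reindex[of "\<lambda>y. x * y" "K - {0}" "\<lambda>y. y"] by (simp add: o_def)
    hence "x ^ card (K - {0}) * \<Prod>(K - {0}) = \<Prod>(K - {0})" by (simp add: prod.distrib)
    moreover have "\<Prod>(K - {0}) \<noteq> 0" by simp
    ultimately have "x ^ (q - 1) = 1" using assms by simp
    hence "x * x ^ (q - 1) = x" by simp
    thus ?thesis using primepow_gt_Suc_0[OF q] by (simp flip: power_Suc)
  qed (use primepow_gt_Suc_0[OF q] in auto)
  hence "K \<subseteq> subfield_of_order q" by (auto simp: subfield_of_order_def)
  thus ?thesis
    using card_subfield_of_order[OF q card n] \<open>card K = q\<close> by (simp add: card_subset_eq)
qed

end

theory Submission
  imports Defs "HOL-Number_Theory.Cong"
begin

text \<open>
  Write \<open>F\<close> for the field with \<open>q ^ n\<close> elements, \<open>K\<close> for its subfield with \<open>q\<close> elements and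
  \<open>f = x ^ \<sigma> + b x ^ (\<sigma>\<^sup>2)\<close>. A pair \<open>(x, t)\<close> that is independent over \<open>K\<close> has \<open>x \<noteq> 0\<close> and
  \<open>t = c x\<close> with \<open>c \<notin> K\<close>. Put \<open>z = c ^ \<sigma> - c\<close>. As raising to the power \<open>\<sigma>\<close> is additive,
  \<open>c ^ (\<sigma>\<^sup>2) - c = z ^ \<sigma> + z\<close>, and so
    \<open>x f(t) - t f(x) = x ^ (\<sigma> + 1) z (1 + b (z ^ (\<sigma> - 1) + 1) (x ^ \<sigma>) ^ (\<sigma> - 1))\<close>.
  The pair therefore witnesses that \<open>f\<close> is not scattered exactly when
    \<open>b\<inverse> w ^ (\<sigma> - 1) + z ^ (\<sigma> - 1) + 1 = 0\<close>, where \<open>w = (x ^ \<sigma>)\<inverse>\<close>.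

  It remains to see which \<open>z\<close> and \<open>w\<close> occur. Because \<open>s\<close> is invertible modulo \<open>n\<close>, some iterate
  of the \<open>\<sigma>\<close>-power map is the \<open>q\<close>-power map on \<open>F\<close> (\<open>ex_iterate_eq_power_q\<close>). This has
  three consequences. The elements fixed by the \<open>\<sigma>\<close>-power map are those of \<open>K\<close>, so \<open>z \<noteq> 0\<close>.
  A count of fibres then gives the additive Hilbert 90 theorem: the values
  \<open>c ^ \<sigma> - c\<close> are precisely the elements of trace zero (\<open>range_power_minus_self\<close>). Finally,
  the nonzero \<open>(\<sigma> - 1)\<close>-th powers are the nonzero \<open>(q - 1)\<close>-th powers
  (\<open>nonzero_powers_eq\<close>), so \<open>w ^ (\<sigma> - 1)\<close> may be replaced by \<open>x\<^sub>0 ^ (q - 1)\<close>; here \<open>w\<close> is an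
  arbitrary nonzero element since the \<open>\<sigma>\<close>-power map is bijective.
\<close>

section \<open>Powers of the Frobenius map\<close>

lemma minus_1_dvd_power_minus_1: "a - 1 dvd a ^ k - (1::nat)"
proof (cases "a = 0")
  case False
  have "int a - 1 dvd int a ^ k - 1"
    by (simp add: power_diff_1_eq)
  hence "int (a - 1) dvd int (a ^ k - 1)"
    using False by (simp add: of_nat_diff)
  thus ?thesis by (simp only: int_dvd_int_iff)
qed (cases k; simp)

locale finite_field_extension =
  fixes q n :: nat and field_type :: "'a::finite_field itself"
  assumes q: "primepow q" and n: "n > 1" and card: "CARD('a) = q ^ n"
begin

lemma q_gt_1: "q > 1"
  using primepow_gt_Suc_0[OF q] by simp

lemma power_q_add: "((x::'a) + y) ^ (q ^ i) = x ^ (q ^ i) + y ^ (q ^ i)"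
proof -
  obtain k where "q = CHAR('a) ^ k"
    using prime_power_CHAR[OF q card] by blast
  hence "q ^ i = CHAR('a) ^ (k * i)" by (simp add: power_mult)
  thus ?thesis by (intro freshmans_dream') auto
qed

lemma power_q_diff: "((x::'a) - y) ^ (q ^ i) = x ^ (q ^ i) - y ^ (q ^ i)"
  using power_q_add[of "x - y" y i] by (simp add: algebra_simps)

lemma power_q_n: "(x::'a) ^ (q ^ (n * m)) = x"
proof (induction m)
  case (Suc m)
  have "x ^ (q ^ (n * Suc m)) = (x ^ (q ^ n)) ^ (q ^ (n * m))"
    by (simp add: power_add flip: power_mult)
  thus ?case using Suc finite_field_power_card_eq_same[of x] card by simp
qed simp

section \<open>The trace\<close>

lemma trace_over_diff: "trace_over q n ((x::'a) - y) = trace_over q n x - trace_over q n y"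
  by (simp add: trace_over_def power_q_diff sum_subtractf)

text \<open>
  Raising to the power \<open>q\<close> permutes the summands of the trace cyclically.
\<close>

lemma trace_over_power: "trace_over q n ((x::'a) ^ (q ^ s)) = trace_over q n x"
proof (induction s)
  case (Suc s)
  have step: "trace_over q n (y ^ q) = trace_over q n y" for y :: 'a
  proof -
    have "trace_over q n (y ^ q) + y = (\<Sum>i<n. y ^ (q ^ Suc i)) + y ^ (q ^ 0)"
      by (simp add: trace_over_def flip: power_mult)
    also have "\<dots> = (\<Sum>i<Suc n. y ^ (q ^ i))"
      by (simp only: sum.lessThan_Suc_shift add.commute)
    also have "\<dots> = trace_over q n y + y"
      using power_q_n[of y 1] by (simp add: trace_over_def)
    finally show ?thesis by simp
  qed
  have "x ^ (q ^ Suc s) = (x ^ (q ^ s)) ^ q"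
    by (simp add: mult.commute flip: power_mult)
  thus ?case using step[of "x ^ (q ^ s)"] Suc by simp
qed simp

text \<open>
  The trace is a polynomial of degree \<open>q ^ (n - 1)\<close>, which bounds the number of its zeros.
\<close>

lemma card_trace_zero_le: "card {y::'a. trace_over q n y = 0} \<le> q ^ (n - 1)"
proof -
  define p where "p = (\<Sum>i<n. Polynomial.monom 1 (q ^ i) :: 'a poly)"
  have "coeff p 1 = (\<Sum>i<n. if i = 0 then 1 else 0)"
    unfolding p_def coeff_sum coeff_monom
    by (rule sum.cong) (use q_gt_1 in \<open>auto simp: nat_power_eq_Suc_0_iff\<close>)
  also have "\<dots> = 1" using n by simp
  finally have "p \<noteq> 0" by auto
  hence "card {y. poly p y = 0} \<le> degree p"
    by (rule card_poly_roots_bound)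
  also have "degree p \<le> q ^ (n - 1)"
    unfolding p_def
  proof (rule degree_sum_le)
    fix i assume "i \<in> {..<n}"
    hence "q ^ i \<le> q ^ (n - 1)" using q_gt_1 by (intro power_increasing) auto
    thus "degree (Polynomial.monom 1 (q ^ i) :: 'a poly) \<le> q ^ (n - 1)"
      by (simp add: degree_monom_eq)
  qed simp
  also have "{y. poly p y = 0} = {y. trace_over q n y = 0}"
    by (simp add: p_def poly_sum poly_monom trace_over_def)
  finally show ?thesis .
qed

section \<open>Generators of the Galois group\<close>

text \<open>
  The \<open>q ^ s\<close>-power map generates the same cyclic group as the \<open>q\<close>-power map, since \<open>s\<close> is
  invertible modulo \<open>n\<close>.
\<close>

lemma ex_iterate_eq_power_q:
  assumes "coprime s n"
  shows "\<exists>k. \<forall>x::'a. x ^ q = x ^ ((q ^ s) ^ k)"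
proof -
  obtain k where "[s * k = Suc 0] (mod n)"
    using cong_solve_coprime_nat[OF assms] by blast
  hence "(s * k) mod n = 1" using n by (simp add: cong_def)
  hence k: "s * k = n * (s * k div n) + 1"
    by (metis mult_div_mod_eq)
  have "x ^ ((q ^ s) ^ k) = x ^ q" for x :: 'a
  proof -
    have eq: "(q ^ s) ^ k = q ^ (n * (s * k div n)) * q"
      using arg_cong[OF k, of "\<lambda>i. q ^ i"] by (simp add: power_mult)
    show ?thesis by (simp only: eq power_mult[of x] power_q_n)
  qed
  thus ?thesis by metis
qed

lemma power_eq_self_iff:
  assumes "coprime s n"
  shows "(x::'a) ^ (q ^ s) = x \<longleftrightarrow> x \<in> subfield_of_order q"
proof
  assume fixed: "x ^ (q ^ s) = x"
  have "x ^ ((q ^ s) ^ k) = x" for k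
    by (induction k) (simp_all add: fixed power_mult)
  thus "x \<in> subfield_of_order q"
    using ex_iterate_eq_power_q[OF assms] by (auto simp: subfield_of_order_def)
next
  assume "x \<in> subfield_of_order q"
  hence "x ^ q = x" by (simp add: subfield_of_order_def)
  thus "x ^ (q ^ s) = x" by (induction s) (simp_all add: power_mult)
qed

text \<open>
  If the \<open>k\<close>-th iterate of the \<open>\<sigma>\<close>-power map is the \<open>q\<close>-power map, where \<open>\<sigma> = q ^ s\<close>, then
  \<open>x ^ (q - 1) = x ^ (\<sigma> ^ k - 1)\<close>, and \<open>\<sigma> - 1\<close> divides \<open>\<sigma> ^ k - 1\<close>. In the other direction
  \<open>q - 1\<close> divides \<open>\<sigma> - 1\<close>.
\<close>

lemma nonzero_powers_eq:
  assumes "coprime s n"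
  shows "(\<lambda>x::'a. x ^ (q - 1)) ` (- {0}) = (\<lambda>x. x ^ (q ^ s - 1)) ` (- {0})"
proof (intro antisym image_subsetI)
  fix x :: 'a assume x: "x \<in> - {0}"
  obtain k where k: "x ^ q = x ^ ((q ^ s) ^ k)"
    using ex_iterate_eq_power_q[OF assms] by blast
  obtain j where j: "(q ^ s) ^ k - 1 = (q ^ s - 1) * j"
    using minus_1_dvd_power_minus_1 by blast
  have "x * x ^ (q - 1) = x ^ q"
    using q_gt_1 by (simp flip: power_Suc)
  also have "\<dots> = x * x ^ ((q ^ s) ^ k - 1)"
    using q_gt_1 k by (simp flip: power_Suc)
  finally have "x ^ (q - 1) = (x ^ j) ^ (q ^ s - 1)"
    using x j by (simp add: mult.commute flip: power_mult)
  thus "x ^ (q - 1) \<in> (\<lambda>x. x ^ (q ^ s - 1)) ` (- {0})"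
    using x by auto
next
  fix x :: 'a assume x: "x \<in> - {0}"
  obtain j where "q ^ s - 1 = (q - 1) * j"
    using minus_1_dvd_power_minus_1 by blast
  hence "x ^ (q ^ s - 1) = (x ^ j) ^ (q - 1)"
    by (simp add: mult.commute flip: power_mult)
  thus "x ^ (q ^ s - 1) \<in> (\<lambda>x. x ^ (q - 1)) ` (- {0})"
    using x by auto
qed

text \<open>
  The additive form of Hilbert's Theorem 90. The image is contained in the kernel of the trace
  because the trace is invariant. Every fibre of \<open>x \<mapsto> x ^ (q ^ s) - x\<close> lies in a coset of the
  subfield with \<open>q\<close> elements, so the image has at least \<open>q ^ (n - 1)\<close> elements, which is as many
  as the kernel of the trace can have.
\<close>

lemma range_power_minus_self:
  assumes "coprime s n"
  shows "range (\<lambda>x::'a. x ^ (q ^ s) - x) = {y. trace_over q n y = 0}"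
proof -
  let ?d = "\<lambda>x::'a. x ^ (q ^ s) - x"
  have fibre: "card {x. ?d x = y} \<le> q" if "y \<in> range ?d" for y
  proof -
    obtain x0 where x0: "y = ?d x0" using \<open>y \<in> range ?d\<close> by blast
    have "x - x0 \<in> subfield_of_order q" if "?d x = y" for x
      using that x0 power_eq_self_iff[OF assms, of "x - x0"]
      by (simp add: power_q_diff algebra_simps)
    hence "{x. ?d x = y} \<subseteq> (\<lambda>u. u + x0) ` subfield_of_order q"
      by (force intro!: image_eqI[where x = "_ - x0"])
    hence "card {x. ?d x = y} \<le> card (subfield_of_order q :: 'a set)"
      by (meson card_image_le card_mono finite order_trans)
    thus ?thesis using card_subfield_of_order[OF q card] n by simp
  qed
  have "q ^ n = card (\<Union>y\<in>range ?d. {x. ?d x = y})"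
    by (simp add: card[symmetric]) (rule arg_cong[where f = card], blast)
  also have "\<dots> \<le> (\<Sum>y\<in>range ?d. card {x. ?d x = y})"
    by (rule card_UN_le) simp
  also have "\<dots> \<le> card (range ?d) * q"
    using sum_bounded_above[OF fibre] by simp
  finally have "q ^ (n - 1) \<le> card (range ?d)"
    using n q_gt_1 by (cases n) simp_all
  hence "card {y::'a. trace_over q n y = 0} \<le> card (range ?d)"
    using card_trace_zero_le by simp
  moreover have "range ?d \<subseteq> {y. trace_over q n y = 0}"
    by (auto simp: trace_over_diff trace_over_power)
  ultimately show ?thesis by (intro card_seteq) simp_all
qed

section \<open>The scattered condition\<close>

lemma lin_dependent_pair_iff:
  "lin_dependent_pair q (x::'a) t \<longleftrightarrow> x = 0 \<or> t / x \<in> subfield_of_order q"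
proof
  note closed = subfield_of_order_closed[OF q card]
  show "x = 0 \<or> t / x \<in> subfield_of_order q" if "lin_dependent_pair q x t"
  proof (cases "x = 0")
    case False
    from that obtain \<alpha> \<beta> where ab: "\<alpha> \<in> subfield_of_order q" "\<beta> \<in> subfield_of_order q"
        "(\<alpha>, \<beta>) \<noteq> (0, 0)" "\<alpha> * x + \<beta> * t = 0"
      unfolding lin_dependent_pair_def by blast
    have "\<beta> \<noteq> 0" using ab(3,4) False by auto
    hence "t / x = - \<alpha> * inverse \<beta>"
      using ab(4) False by (simp add: field_simps add_eq_0_iff)
    thus ?thesis using closed ab(1,2) by metis
  qed simp
  show "lin_dependent_pair q x t" if "x = 0 \<or> t / x \<in> subfield_of_order q"
  proof (cases "x = 0")
    case True
    thus ?thesis unfolding lin_dependent_pair_def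
      by (intro bexI[of _ 1] bexI[of _ 0]) (use closed in auto)
  next
    case False
    thus ?thesis using that unfolding lin_dependent_pair_def
      by (intro bexI[of _ "t / x"] bexI[of _ "- 1"]) (use closed in auto)
  qed
qed

lemma linearized_poly_binomial:
  "linearized_poly q (Polynomial.monom 1 (q ^ i) + Polynomial.monom (b::'a) (q ^ j))"
  by (auto simp: linearized_poly_def split: if_splits)

text \<open>
  The factorisation rests on \<open>c ^ (\<sigma>\<^sup>2) - c = z ^ \<sigma> + z\<close>. Its factor \<open>z\<close> accounts for the
  dependent pairs, and the last factor for the curve.
\<close>

lemma binomial_cross_difference:
  fixes s :: nat and b x c :: 'a
  defines "\<sigma> \<equiv> q ^ s"
  defines "f \<equiv> Polynomial.monom 1 \<sigma> + Polynomial.monom b (\<sigma> ^ 2)"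
  defines "z \<equiv> c ^ \<sigma> - c"
  shows "x * poly f (c * x) - c * x * poly f x =
           x ^ Suc \<sigma> * (z * (1 + b * (z ^ (\<sigma> - 1) + 1) * (x ^ \<sigma>) ^ (\<sigma> - 1)))"
proof -
  have \<sigma>: "\<sigma> > 0" using q_gt_1 by (simp add: \<sigma>_def)
  have up: "y ^ \<sigma> = y * y ^ (\<sigma> - 1)" for y :: 'a
    using \<sigma> by (simp flip: power_Suc)
  have sq: "y ^ (\<sigma>\<^sup>2) = (y ^ \<sigma>) ^ \<sigma>" for y :: 'a
    by (simp add: power2_eq_square power_mult)
  have z_pow: "c ^ (\<sigma>\<^sup>2) - c ^ \<sigma> = z ^ \<sigma>"
    unfolding sq z_def by (simp add: \<sigma>_def power_q_diff)
  have "x * poly f (c * x) - c * x * poly f x =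
          x * (z * x ^ \<sigma> + b * (c ^ (\<sigma>\<^sup>2) - c) * x ^ (\<sigma>\<^sup>2))"
    by (simp add: f_def poly_monom power_mult_distrib z_def algebra_simps)
  also have "c ^ (\<sigma>\<^sup>2) - c = z * z ^ (\<sigma> - 1) + z"
    using z_pow up[of z] by (simp add: z_def algebra_simps)
  also have "x ^ (\<sigma>\<^sup>2) = x ^ \<sigma> * (x ^ \<sigma>) ^ (\<sigma> - 1)"
    using up[of "x ^ \<sigma>"] by (simp add: sq)
  finally show ?thesis by (simp add: algebra_simps)
qed

lemma not_scattered_binomial_iff:
  fixes s :: nat and b :: 'a
  assumes s: "coprime s n" and b: "b \<noteq> 0"
  defines "\<sigma> \<equiv> q ^ s"
  shows "\<not> scattered q (Polynomial.monom 1 \<sigma> + Polynomial.monom b (\<sigma> ^ 2)) \<longleftrightarrow>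
    (\<exists>x c. x \<noteq> 0 \<and> c \<notin> subfield_of_order q \<and>
       inverse b * inverse (x ^ \<sigma>) ^ (\<sigma> - 1) + (c ^ \<sigma> - c) ^ (\<sigma> - 1) + 1 = 0)"
    (is "\<not> scattered q ?f \<longleftrightarrow> (\<exists>x c. x \<noteq> 0 \<and> c \<notin> _ \<and> ?E x c)")
proof -
  have \<sigma>: "\<sigma> > 0" using q_gt_1 by (simp add: \<sigma>_def)
  have lin: "linearized_poly q ?f"
    using linearized_poly_binomial[of s b "s * 2"] by (simp add: \<sigma>_def power_mult)
  have f0: "0 * poly ?f t - t * poly ?f 0 = 0" for t
    using \<sigma> by (simp add: poly_monom zero_power)
  have cross: "x * poly ?f (c * x) - c * x * poly ?f x = 0 \<longleftrightarrow>
      c \<in> subfield_of_order q \<or> ?E x c" if x: "x \<noteq> 0" for x c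
  proof -
    define z w where "z = c ^ \<sigma> - c" and "w = (x ^ \<sigma>) ^ (\<sigma> - 1)"
    have w: "w \<noteq> 0" "inverse (x ^ \<sigma>) ^ (\<sigma> - 1) = inverse w"
      using x by (simp_all add: w_def power_inverse)
    have "x * poly ?f (c * x) - c * x * poly ?f x =
        x ^ Suc \<sigma> * (z * (1 + b * (z ^ (\<sigma> - 1) + 1) * w))"
      unfolding z_def w_def \<sigma>_def by (rule binomial_cross_difference)
    moreover have "z = 0 \<longleftrightarrow> c \<in> subfield_of_order q"
      using power_eq_self_iff[OF s, of c] by (simp add: z_def \<sigma>_def)
    moreover have "1 + b * (z ^ (\<sigma> - 1) + 1) * w =
        b * w * (inverse b * inverse w + z ^ (\<sigma> - 1) + 1)"
      using w(1) b by (simp add: field_simps)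
    ultimately show ?thesis
      unfolding w(2) z_def[symmetric] using x w(1) b by simp
  qed
  have "x * poly ?f t - t * poly ?f x = 0 \<longleftrightarrow> x = 0 \<or> t / x \<in> subfield_of_order q"
    if "x \<noteq> 0 \<longrightarrow> (x * poly ?f t - t * poly ?f x = 0 \<longleftrightarrow> t / x \<in> subfield_of_order q)" for x t
    using that f0[of t] by (cases "x = 0") (simp_all del: poly_add)
  hence "scattered q ?f \<longleftrightarrow>
      (\<forall>x t. x \<noteq> 0 \<longrightarrow> (x * poly ?f t - t * poly ?f x = 0 \<longleftrightarrow> t / x \<in> subfield_of_order q))"
    using lin unfolding scattered_def lin_dependent_pair_iff by blast
  also have "\<dots> \<longleftrightarrow> (\<forall>x c. x \<noteq> 0 \<longrightarrow>
      (x * poly ?f (c * x) - c * x * poly ?f x = 0 \<longleftrightarrow> c \<in> subfield_of_order q))"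
    by (metis nonzero_eq_divide_eq)
  also have "\<dots> \<longleftrightarrow> (\<forall>x c. x \<noteq> 0 \<longrightarrow> ?E x c \<longrightarrow> c \<in> subfield_of_order q)"
    using cross by blast
  finally show ?thesis by blast
qed

end

theorem proposition3p10:
  fixes q n s \<sigma> :: nat and b :: "'a::finite_field"
  assumes "primepow q" and "n \<ge> 3" and "s \<ge> 1" and "coprime s n"
    and "\<sigma> = q ^ s"
    and "CARD('a) = q ^ n"
    and "b \<noteq> 0"
  shows "\<not> scattered q (Polynomial.monom 1 \<sigma> + Polynomial.monom b (\<sigma> ^ 2)) \<longleftrightarrow>
    (\<exists>x\<^sub>0 y\<^sub>0. (x\<^sub>0, y\<^sub>0) \<in> curve_points q \<sigma> b \<and> x\<^sub>0 \<noteq> 0 \<and> y\<^sub>0 \<noteq> 0 \<and>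
       trace_over q n y\<^sub>0 = 0)"
    (is "?lhs \<longleftrightarrow> ?rhs")
proof -
  interpret finite_field_extension q n "TYPE('a)"
    by unfold_locales (use assms in auto)
  note s = \<open>coprime s n\<close> and \<sigma> = \<open>\<sigma> = q ^ s\<close>
  have in_K: "c ^ \<sigma> - c = 0 \<longleftrightarrow> c \<in> subfield_of_order q" for c :: 'a
    using power_eq_self_iff[OF s, of c] by (simp add: \<sigma>)
  have hilbert90: "trace_over q n y = 0 \<longleftrightarrow> (\<exists>c. y = c ^ \<sigma> - c)" for y :: 'a
    using range_power_minus_self[OF s] by (auto simp: \<sigma>)
  have powers: "(\<exists>x. x \<noteq> 0 \<and> P (x ^ (q - 1))) \<longleftrightarrow> (\<exists>x. x \<noteq> 0 \<and> P (inverse (x ^ \<sigma>) ^ (\<sigma> - 1)))"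
    for P :: "'a \<Rightarrow> bool"
  proof -
    \<comment> \<open>As \<open>\<sigma> ^ n\<close> is a power of \<open>q ^ n\<close>, the \<open>\<sigma>\<close>-power map is inverted by its \<open>(n - 1)\<close>-fold iterate.\<close>
    have "(inverse w ^ (\<sigma> ^ (n - 1))) ^ \<sigma> = inverse w" for w :: 'a
    proof -
      have "\<sigma> ^ (n - 1) * \<sigma> = \<sigma> ^ n"
        using n by (cases n) simp_all
      also have "\<dots> = q ^ (n * s)"
        by (simp add: \<sigma> mult.commute flip: power_mult)
      finally have "\<sigma> ^ (n - 1) * \<sigma> = q ^ (n * s)" .
      thus ?thesis using power_q_n[of "inverse w" s] by (simp flip: power_mult)
    qed
    hence "\<exists>x. x \<noteq> 0 \<and> w = inverse (x ^ \<sigma>)" if "w \<noteq> 0" for w :: 'a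
      using that by (intro exI[of _ "inverse w ^ (\<sigma> ^ (n - 1))"]) simp
    hence "(\<exists>x. x \<noteq> 0 \<and> P (inverse (x ^ \<sigma>) ^ (\<sigma> - 1))) \<longleftrightarrow> (\<exists>w. w \<noteq> 0 \<and> P (w ^ (\<sigma> - 1)))"
      by (metis inverse_nonzero_iff_nonzero power_not_zero)
    also have "\<dots> \<longleftrightarrow> (\<exists>u\<in>(\<lambda>w. w ^ (q ^ s - 1)) ` (- {0}). P u)"
      by (auto simp: \<sigma>)
    also have "\<dots> \<longleftrightarrow> (\<exists>x. x \<noteq> 0 \<and> P (x ^ (q - 1)))"
      unfolding nonzero_powers_eq[OF s, symmetric] by auto
    finally show ?thesis by blast
  qed
  have "?rhs \<longleftrightarrow> (\<exists>y. y \<noteq> 0 \<and> trace_over q n y = 0 \<and>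
      (\<exists>x. x \<noteq> 0 \<and> inverse b * x ^ (q - 1) + y ^ (\<sigma> - 1) + 1 = 0))"
    unfolding curve_points_def by auto
  also have "\<dots> \<longleftrightarrow> (\<exists>y. y \<noteq> 0 \<and> trace_over q n y = 0 \<and>
      (\<exists>x. x \<noteq> 0 \<and> inverse b * inverse (x ^ \<sigma>) ^ (\<sigma> - 1) + y ^ (\<sigma> - 1) + 1 = 0))"
    using powers[of "\<lambda>u. inverse b * u + _ ^ (\<sigma> - 1) + 1 = 0"] by simp
  also have "\<dots> \<longleftrightarrow> (\<exists>x c. x \<noteq> 0 \<and> c \<notin> subfield_of_order q \<and>
      inverse b * inverse (x ^ \<sigma>) ^ (\<sigma> - 1) + (c ^ \<sigma> - c) ^ (\<sigma> - 1) + 1 = 0)"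
    unfolding hilbert90 using in_K by metis
  also have "\<dots> \<longleftrightarrow> ?lhs"
    using not_scattered_binomial_iff[OF s \<open>b \<noteq> 0\<close>] by (simp add: \<sigma>)
  finally show ?thesis by blast
qed

end
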